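(* The $\mathbb{F}$-algebra $U^{\vee}_q$ has a presentation by generators $x,y^{-1},z$ and relations $$\frac{qy^{-1}x-q^{-1}xy^{-1}}{q-q^{-1}} = y^{-2},\qquad \frac{qzy^{-1}-q^{-1}y^{-1}z}{q-q^{-1}} = y^{-2},\qquad \frac{qzx-q^{-1}xz}{q-q^{-1}} = 1.$$
   Context: Algebras are associative with $1$, and a subalgebra has the same $1$ as the parent algebra. $\mathbb{F}$ is a field and $q\in\mathbb{F}$ is nonzero with $q^4\neq 1$. $U_q(\mathfrak{sl}_2)$ is the $\mathbb{F}$-algebra with generators $x,y^{\pm1},z$ and relations $yy^{-1}=y^{-1}y=1$, $$\frac{qxy-q^{-1}yx}{q-q^{-1}} = 1,\qquad \frac{qyz-q^{-1}zy}{q-q^{-1}} = 1,\qquad \frac{qzx-q^{-1}xz}{q-q^{-1}} = 1$$ (the equitable presentation). $U^\vee_q$ is the subalgebra of $U_q(\mathfrak{sl}_2)$ generated by $x,y^{-1},z$. In the claim, $y^{-1}$ is treated as a single generator symbol (not required to be invertible) and $y^{-2}=(y^{-1})^2$. *)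

theory Defs
  imports
    "HOL-Library.Poly_Mapping"
    "HOL-Algebra.Module"
    "HOL-Algebra.QuotRing"
    "HOL-Algebra.Subrings"
begin

section \<open>Free associative algebras\<close>

text \<open>
  The words over \<open>'g\<close> form the free monoid, written additively because \<^theory>\<open>HOL-Library.Poly_Mapping\<close>
  turns finitely supported functions on an additive (not necessarily commutative) monoid into its
  monoid ring. So \<open>('g, 'k) free_alg\<close>, with its ring multiplication \<open>(*)\<close>, is the
  free associative unital algebra on \<open>'g\<close> over \<open>'k\<close>.
\<close>

datatype 'g free_monoid = Word (letters: "'g list")

instantiation free_monoid :: (type) monoid_add
begin

definition zero_free_monoid :: "'a free_monoid"
  where "0 = Word []"

definition plus_free_monoid :: "'a free_monoid \<Rightarrow> 'a free_monoid \<Rightarrow> 'a free_monoid"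
  where "u + v = Word (letters u @ letters v)"

instance
  by standard (simp_all add: zero_free_monoid_def plus_free_monoid_def)

end

type_synonym ('g, 'k) free_alg = "'g free_monoid \<Rightarrow>\<^sub>0 'k"

definition free_gen :: "'g \<Rightarrow> ('g, 'k::field) free_alg"
  where "free_gen g = Poly_Mapping.single (Word [g]) 1"

definition scale :: "'k \<Rightarrow> ('g, 'k::field) free_alg \<Rightarrow> ('g, 'k) free_alg"
  where "scale c p = Poly_Mapping.single 0 c * p"

lemma lookup_scale: "Poly_Mapping.lookup (scale c p) w = c * Poly_Mapping.lookup p w"
proof (induction p rule: update_induct)
  case const
  then show ?case by (simp add: scale_def)
next
  case (update p a b)
  then have "Poly_Mapping.update a b p = p + Poly_Mapping.single a b"
    by (intro poly_mapping_eqI)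
       (auto simp: lookup_add lookup_update lookup_single when_def in_keys_iff)
  with update show ?case
    by (simp add: scale_def distrib_left lookup_add mult_single lookup_single when_def)
qed

definition free_algebra :: "('k::field, ('g, 'k) free_alg) module"
  where "free_algebra =
    \<lparr>carrier = UNIV, mult = (*), one = 1, zero = 0, add = (+), smult = scale\<rparr>"


section \<open>Associative algebras over a field\<close>

text \<open>
  The locale \<^locale>\<open>algebra\<close> of HOL-Algebra is restricted to commutative algebras; we keep its record
  \<^typ>\<open>('k, 'a) module\<close>, with the ground field given by a type.
\<close>

locale assoc_algebra = ring A for A :: "('k::field, 'a) module" (structure) +
  assumes smult_closed: "x \<in> carrier A \<Longrightarrow> c \<odot> x \<in> carrier A"
    and smult_add_left: "x \<in> carrier A \<Longrightarrow> (c + d) \<odot> x = c \<odot> x \<oplus> d \<odot> x"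
    and smult_add_right:
      "x \<in> carrier A \<Longrightarrow> y \<in> carrier A \<Longrightarrow> c \<odot> (x \<oplus> y) = c \<odot> x \<oplus> c \<odot> y"
    and smult_smult: "x \<in> carrier A \<Longrightarrow> c \<odot> (d \<odot> x) = (c * d) \<odot> x"
    and smult_one: "x \<in> carrier A \<Longrightarrow> 1 \<odot> x = x"
    and smult_mult_left:
      "x \<in> carrier A \<Longrightarrow> y \<in> carrier A \<Longrightarrow> (c \<odot> x) \<otimes> y = c \<odot> (x \<otimes> y)"
    and smult_mult_right:
      "x \<in> carrier A \<Longrightarrow> y \<in> carrier A \<Longrightarrow> x \<otimes> (c \<odot> y) = c \<odot> (x \<otimes> y)"

definition alg_iso :: "('k::field, 'a) module \<Rightarrow> ('k, 'b) module \<Rightarrow> ('a \<Rightarrow> 'b) set"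
  where "alg_iso A B =
    {\<phi> \<in> ring_iso A B. \<forall>c. \<forall>x\<in>carrier A. \<phi> (c \<odot>\<^bsub>A\<^esub> x) = c \<odot>\<^bsub>B\<^esub> \<phi> x}"

definition is_subalgebra :: "'a set \<Rightarrow> ('k::field, 'a) module \<Rightarrow> bool"
  where "is_subalgebra H A \<longleftrightarrow> subring H A \<and> (\<forall>c. \<forall>x\<in>H. c \<odot>\<^bsub>A\<^esub> x \<in> H)"

definition generated_subalgebra :: "('k::field, 'a) module \<Rightarrow> 'a set \<Rightarrow> ('k, 'a) module"
  where "generated_subalgebra A S = A\<lparr>carrier := \<Inter>{H. is_subalgebra H A \<and> S \<subseteq> H}\<rparr>"


section \<open>Presentations\<close>

text \<open>A relation \<open>l = r\<close> is given as the pair \<open>(l, r)\<close>. Ideals in HOL-Algebra are two-sided.\<close>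

definition relation_ideal ::
  "(('g, 'k::field) free_alg \<times> ('g, 'k) free_alg) set \<Rightarrow> ('g, 'k) free_alg set"
  where "relation_ideal rels = Idl\<^bsub>free_algebra\<^esub> {l - r | l r. (l, r) \<in> rels}"

definition presented_algebra ::
  "(('g, 'k::field) free_alg \<times> ('g, 'k) free_alg) set \<Rightarrow> ('k, ('g, 'k) free_alg set) module"
  where "presented_algebra rels =
    (let I = relation_ideal rels; Q = free_algebra Quot I in
      \<lparr>carrier = carrier Q, mult = mult Q, one = one Q, zero = zero Q, add = add Q,
       smult = (\<lambda>c X. \<Union>p\<in>X. I +>\<^bsub>free_algebra\<^esub> scale c p)\<rparr>)"

definition presented_gen ::
  "(('g, 'k::field) free_alg \<times> ('g, 'k) free_alg) set \<Rightarrow> 'g \<Rightarrow> ('g, 'k) free_alg set"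
  where "presented_gen rels g = relation_ideal rels +>\<^bsub>free_algebra\<^esub> free_gen g"

definition has_presentation ::
  "('k::field, 'a) module \<Rightarrow> ('g \<Rightarrow> 'a) \<Rightarrow> (('g, 'k) free_alg \<times> ('g, 'k) free_alg) set \<Rightarrow> bool"
  where "has_presentation A a rels \<longleftrightarrow>
    (\<exists>\<phi> \<in> alg_iso (presented_algebra rels) A. \<forall>g. \<phi> (presented_gen rels g) = a g)"

lemma ring_free_algebra: "ring (free_algebra :: ('k::field, ('g, 'k) free_alg) module)" (is "ring ?A")
proof (rule ringI)
  show "abelian_group ?A"
  proof (rule abelian_groupI)
    fix x :: "('g, 'k) free_alg"
    show "\<exists>y\<in>carrier ?A. y \<oplus>\<^bsub>?A\<^esub> x = \<zero>\<^bsub>?A\<^esub>"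
      by (rule bexI[of _ "- x"]) (simp_all add: free_algebra_def)
  qed (simp_all add: free_algebra_def add_ac)
  show "Group.monoid ?A"
    by (rule monoidI) (simp_all add: free_algebra_def mult.assoc)
qed (simp_all add: free_algebra_def distrib_left distrib_right)

lemma ideal_relation_ideal: "ideal (relation_ideal rels) free_algebra"
  unfolding relation_ideal_def
  by (rule ring.genideal_ideal[OF ring_free_algebra]) (simp add: free_algebra_def)

lemma presented_smult_coset:
  "c \<odot>\<^bsub>presented_algebra rels\<^esub> (relation_ideal rels +>\<^bsub>free_algebra\<^esub> p) =
    relation_ideal rels +>\<^bsub>free_algebra\<^esub> scale c p"
proof -
  let ?I = "relation_ideal rels"
  interpret I: ideal ?I free_algebra
    by (rule ideal_relation_ideal)
  have coset: "?I +>\<^bsub>free_algebra\<^esub> r = {i + r | i. i \<in> ?I}" for r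
    by (auto simp: a_r_coset_def' free_algebra_def)
  have zero: "0 \<in> ?I"
    using additive_subgroup.zero_closed[OF I.additive_subgroup_axioms] by (simp add: free_algebra_def)
  have add: "i + j \<in> ?I" if "i \<in> ?I" "j \<in> ?I" for i j
    using additive_subgroup.a_closed[OF I.additive_subgroup_axioms that] by (simp add: free_algebra_def)
  have neg: "- i \<in> ?I" if "i \<in> ?I" for i
    using I.I_l_closed[OF that, of "- 1"] by (simp add: free_algebra_def)
  have scale: "scale c i \<in> ?I" if "i \<in> ?I" for i
    using I.I_l_closed[OF that, of "Poly_Mapping.single 0 c"]
    by (simp add: free_algebra_def scale_def)
  have *: "scale c (i + p) = scale c i + scale c p" for i
    by (simp add: scale_def distrib_left)
  have "?I +>\<^bsub>free_algebra\<^esub> scale c (i + p) = ?I +>\<^bsub>free_algebra\<^esub> scale c p"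
    if "i \<in> ?I" for i
  proof (intro Set.set_eqI iffI)
    fix t assume "t \<in> ?I +>\<^bsub>free_algebra\<^esub> scale c (i + p)"
    then obtain j where "j \<in> ?I" "t = (j + scale c i) + scale c p"
      by (auto simp: coset * add.assoc)
    then show "t \<in> ?I +>\<^bsub>free_algebra\<^esub> scale c p"
      using add scale that by (auto simp: coset)
  next
    fix t assume "t \<in> ?I +>\<^bsub>free_algebra\<^esub> scale c p"
    then obtain j where "j \<in> ?I" "t = (j + - scale c i) + scale c (i + p)"
      by (auto simp: coset *)
    then show "t \<in> ?I +>\<^bsub>free_algebra\<^esub> scale c (i + p)"
      using add[OF _ neg[OF scale[OF that]]] unfolding coset by blast
  qed
  then have "(\<Union>r\<in>?I +>\<^bsub>free_algebra\<^esub> p. ?I +>\<^bsub>free_algebra\<^esub> scale c r) =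
      ?I +>\<^bsub>free_algebra\<^esub> scale c p"
    using zero by (auto simp: coset[of p])
  then show ?thesis
    by (simp add: presented_algebra_def Let_def)
qed

lemma assoc_algebra_presented_algebra: "assoc_algebra (presented_algebra rels)"
proof -
  let ?I = "relation_ideal rels" and ?A = "presented_algebra rels"
  interpret I: ideal ?I free_algebra
    by (rule ideal_relation_ideal)
  interpret Q: ring "free_algebra Quot ?I"
    by (rule I.quotient_is_ring)
  have carrierE: "\<exists>p. X = ?I +>\<^bsub>free_algebra\<^esub> p" if "X \<in> carrier ?A" for X
    using that
    by (auto simp: presented_algebra_def Let_def FactRing_def A_RCOSETS_def' a_r_coset_def' free_algebra_def)
  have mem: "?I +>\<^bsub>free_algebra\<^esub> p \<in> carrier ?A" for p
    by (auto simp: presented_algebra_def Let_def FactRing_def A_RCOSETS_def' a_r_coset_def' free_algebra_def)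
  have add: "(?I +>\<^bsub>free_algebra\<^esub> p) \<oplus>\<^bsub>?A\<^esub> (?I +>\<^bsub>free_algebra\<^esub> r)
      = ?I +>\<^bsub>free_algebra\<^esub> (p + r)" for p r
    using I.a_rcos_sum[of p r]
    by (simp add: presented_algebra_def Let_def FactRing_def free_algebra_def)
  have mult: "(?I +>\<^bsub>free_algebra\<^esub> p) \<otimes>\<^bsub>?A\<^esub> (?I +>\<^bsub>free_algebra\<^esub> r)
      = ?I +>\<^bsub>free_algebra\<^esub> (p * r)" for p r
    using I.rcoset_mult_add[of p r]
    by (simp add: presented_algebra_def Let_def FactRing_def free_algebra_def)
  note ops = add mult presented_smult_coset
  have scale: "scale (c + d) p = scale c p + scale d p"
      "scale c (p + r) = scale c p + scale c r"
      "scale c (scale d p) = scale (c * d) p" "scale 1 p = p"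
      "scale c p * r = scale c (p * r)" for c d and p r :: "('g, 'k::field) free_alg"
    by (simp_all add: scale_def single_add distrib_left distrib_right mult.assoc[symmetric]
        mult_single single_one)
  have scale_right: "p * scale c r = scale c (p * r)" for c and p r :: "('g, 'k::field) free_alg"
  proof -
    have "Poly_Mapping.single 0 c * p = p * Poly_Mapping.single 0 c"
    proof (induction p rule: update_induct)
      case const
      then show ?case by simp
    next
      case (update p a b)
      then have "Poly_Mapping.update a b p = p + Poly_Mapping.single a b"
        by (intro poly_mapping_eqI)
           (auto simp: lookup_add lookup_update lookup_single when_def in_keys_iff)
      with update show ?case
        by (simp add: distrib_left distrib_right mult_single mult.commute)
    qed
    then show ?thesis by (simp add: scale_def mult.assoc[symmetric])
  qed
  have one: "\<one>\<^bsub>?A\<^esub> = ?I +>\<^bsub>free_algebra\<^esub> 1"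
    by (simp add: presented_algebra_def Let_def FactRing_def free_algebra_def)
  have zero: "\<zero>\<^bsub>?A\<^esub> = ?I +>\<^bsub>free_algebra\<^esub> 0"
    by (simp add: presented_algebra_def Let_def FactRing_def a_r_coset_def' free_algebra_def)
  have "ring ?A"
  proof (rule ringI)
    show "abelian_group ?A"
    proof (rule abelian_groupI)
      fix X assume "X \<in> carrier ?A"
      then obtain p where p: "X = ?I +>\<^bsub>free_algebra\<^esub> p" using carrierE by blast
      show "\<exists>Y\<in>carrier ?A. Y \<oplus>\<^bsub>?A\<^esub> X = \<zero>\<^bsub>?A\<^esub>"
        by (rule bexI[of _ "?I +>\<^bsub>free_algebra\<^esub> (- p)"]) (simp_all add: p add zero mem)
    qed (auto dest!: carrierE simp: add zero mem add_ac)
    show "Group.monoid ?A"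
      by (rule monoidI) (auto dest!: carrierE simp: mult one mem mult.assoc)
  qed (auto dest!: carrierE simp: add mult distrib_left distrib_right)
  then interpret A: ring ?A .
  show ?thesis
  proof
    fix X Y c d
    assume "X \<in> carrier ?A"
    then obtain p where p: "X = ?I +>\<^bsub>free_algebra\<^esub> p" using carrierE by blast
    show "c \<odot>\<^bsub>?A\<^esub> X \<in> carrier ?A" by (simp only: p ops mem)
    show "(c + d) \<odot>\<^bsub>?A\<^esub> X = c \<odot>\<^bsub>?A\<^esub> X \<oplus>\<^bsub>?A\<^esub> d \<odot>\<^bsub>?A\<^esub> X"
      by (simp only: p ops scale)
    show "c \<odot>\<^bsub>?A\<^esub> (d \<odot>\<^bsub>?A\<^esub> X) = (c * d) \<odot>\<^bsub>?A\<^esub> X"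
      by (simp only: p ops scale)
    show "1 \<odot>\<^bsub>?A\<^esub> X = X" by (simp only: p ops scale)
    assume "Y \<in> carrier ?A"
    then obtain r where r: "Y = ?I +>\<^bsub>free_algebra\<^esub> r" using carrierE by blast
    show "c \<odot>\<^bsub>?A\<^esub> (X \<oplus>\<^bsub>?A\<^esub> Y) = c \<odot>\<^bsub>?A\<^esub> X \<oplus>\<^bsub>?A\<^esub> c \<odot>\<^bsub>?A\<^esub> Y"
      by (simp only: p r ops scale)
    show "(c \<odot>\<^bsub>?A\<^esub> X) \<otimes>\<^bsub>?A\<^esub> Y = c \<odot>\<^bsub>?A\<^esub> (X \<otimes>\<^bsub>?A\<^esub> Y)"
      by (simp only: p r ops scale)
    show "X \<otimes>\<^bsub>?A\<^esub> (c \<odot>\<^bsub>?A\<^esub> Y) = c \<odot>\<^bsub>?A\<^esub> (X \<otimes>\<^bsub>?A\<^esub> Y)"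
      by (simp only: p r ops scale_right)
  qed
qed


section \<open>The equitable presentation of \<open>U\<^sub>q(sl\<^sub>2)\<close>\<close>

definition q_bracket ::
  "'k \<Rightarrow> ('g, 'k::field) free_alg \<Rightarrow> ('g, 'k) free_alg \<Rightarrow> ('g, 'k) free_alg"
  where "q_bracket q a b =
    scale (1 / (q - inverse q)) (scale q (a * b) - scale (inverse q) (b * a))"

datatype uq_symbol = Uq_x | Uq_y | Uq_yinv | Uq_z

definition Uq_relations :: "'k::field \<Rightarrow> ((uq_symbol, 'k) free_alg \<times> (uq_symbol, 'k) free_alg) set"
  where "Uq_relations q =
    (let x = free_gen Uq_x; y = free_gen Uq_y; y' = free_gen Uq_yinv; z = free_gen Uq_z in
      {(y * y', 1), (y' * y, 1),
       (q_bracket q x y, 1), (q_bracket q y z, 1), (q_bracket q z x, 1)})"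

definition Uq :: "'k::field \<Rightarrow> ('k, (uq_symbol, 'k) free_alg set) module"
  where "Uq q = presented_algebra (Uq_relations q)"

definition Uq_gen :: "'k::field \<Rightarrow> uq_symbol \<Rightarrow> (uq_symbol, 'k) free_alg set"
  where "Uq_gen q = presented_gen (Uq_relations q)"

definition Uq_vee :: "'k::field \<Rightarrow> ('k, (uq_symbol, 'k) free_alg set) module"
  where "Uq_vee q = generated_subalgebra (Uq q) {Uq_gen q Uq_x, Uq_gen q Uq_yinv, Uq_gen q Uq_z}"

datatype vee_symbol = Vee_x | Vee_yinv | Vee_z

primrec Uq_vee_gen :: "'k::field \<Rightarrow> vee_symbol \<Rightarrow> (uq_symbol, 'k) free_alg set"
  where
    "Uq_vee_gen q Vee_x = Uq_gen q Uq_x"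
  | "Uq_vee_gen q Vee_yinv = Uq_gen q Uq_yinv"
  | "Uq_vee_gen q Vee_z = Uq_gen q Uq_z"

definition vee_relations ::
  "'k::field \<Rightarrow> ((vee_symbol, 'k) free_alg \<times> (vee_symbol, 'k) free_alg) set"
  where "vee_relations q =
    (let x = free_gen Vee_x; y' = free_gen Vee_yinv; z = free_gen Vee_z in
      {(q_bracket q y' x, y' ^ 2), (q_bracket q z y', y' ^ 2), (q_bracket q z x, 1)})"

end

theory Submission
  imports Defs
begin

text \<open>
  Write \<open>w = y\<^sup>-\<^sup>1\<close>. Multiplying a defining relation of \<open>U\<^sub>q(sl\<^sub>2)\<close> that involves \<open>y\<close> by
  \<open>w\<close> on both sides gives a relation between \<open>x\<close>, \<open>w\<close>, \<open>z\<close>, so the presented algebra maps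
  onto \<open>U\<^sub>q\<^sup>\<or>\<close>. For injectivity, let \<open>U\<^sub>q(sl\<^sub>2)\<close> act on the space with basis indexed by
  \<open>(j, i, k)\<close>, \<open>j \<in> \<int>\<close>, as it does by left multiplication on the monomials \<open>y\<^sup>j x\<^sup>i z\<^sup>k\<close>, and send
  the basis vectors with \<open>j \<le> 0\<close> to \<open>w\<^sup>-\<^sup>j x\<^sup>i z\<^sup>k\<close> in the presented algebra. Applying an element
  of the presented algebra to the vector \<open>(0, 0, 0)\<close> and mapping back returns the element, so
  elements acting as zero vanish.
\<close>

section \<open>Linear extension\<close>

lemma poly_mapping_single_induct [case_names zero single_add]:
  fixes p :: "'a \<Rightarrow>\<^sub>0 'b::monoid_add"
  assumes "P 0" and "\<And>p a c. P p \<Longrightarrow> P (p + Poly_Mapping.single a c)"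
  shows "P p"
proof (induction p rule: update_induct)
  case const
  then show ?case by (rule assms)
next
  case (update p a b)
  then have "Poly_Mapping.update a b p = p + Poly_Mapping.single a b"
    by (intro poly_mapping_eqI)
       (auto simp: lookup_add lookup_update lookup_single when_def in_keys_iff)
  with update assms(2) show ?case by simp
qed

text \<open>Unlike \<open>scale\<close>, this needs no monoid structure on the index type, so one
  operation serves both the free algebras and the module on which they act.\<close>

definition smul :: "'k \<Rightarrow> ('a \<Rightarrow>\<^sub>0 'k::comm_ring_1) \<Rightarrow> 'a \<Rightarrow>\<^sub>0 'k"
  where "smul c p = Poly_Mapping.map ((*) c) p"

lemma lookup_smul [simp]: "Poly_Mapping.lookup (smul c p) a = c * Poly_Mapping.lookup p a"
  by (simp add: smul_def map.rep_eq when_def)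

lemma scale_eq_smul: "scale c p = smul c p"
  by (rule poly_mapping_eqI) (simp add: lookup_scale)

lemma smul_zero [simp]: "smul c 0 = 0" "smul 0 p = 0"
  and smul_one [simp]: "smul 1 p = p"
  and smul_smul [simp]: "smul c (smul d p) = smul (c * d) p"
  and smul_add: "smul c (p + r) = smul c p + smul c r"
  and smul_diff: "smul c (p - r) = smul c p - smul c r"
  and smul_add_left: "smul (c + d) p = smul c p + smul d p"
  by (rule poly_mapping_eqI, simp add: lookup_add lookup_minus algebra_simps)+

lemma smul_single [simp]: "smul c (Poly_Mapping.single a d) = Poly_Mapping.single a (c * d)"
  by (rule poly_mapping_eqI) (simp add: lookup_single when_def)

lemma smul_sum: "smul c (sum f A) = (\<Sum>a\<in>A. smul c (f a))"
  by (induction A rule: infinite_finite_induct) (simp_all add: smul_add)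

lemma mult_smul_left [simp]: "smul c p * r = smul c (p * r)"
  for p r :: "'a::monoid_add \<Rightarrow>\<^sub>0 'k::comm_ring_1"
  by (simp add: smul_def mult_map_scale_conv_mult mult.assoc)

lemma mult_smul_right [simp]: "p * smul c r = smul c (p * r)"
  for p r :: "'a::monoid_add \<Rightarrow>\<^sub>0 'k::comm_ring_1"
proof (induction p rule: poly_mapping_single_induct)
  case zero
  then show ?case by simp
next
  case (single_add p a d)
  have "Poly_Mapping.single a d * smul c r = smul c (Poly_Mapping.single a d * r)"
    by (simp add: smul_def mult_map_scale_conv_mult mult.assoc[symmetric] mult_single mult.commute)
  with single_add show ?case by (simp add: distrib_right smul_add)
qed

definition lin_ext :: "('a \<Rightarrow> 'b \<Rightarrow>\<^sub>0 'k) \<Rightarrow> ('a \<Rightarrow>\<^sub>0 'k) \<Rightarrow> 'b \<Rightarrow>\<^sub>0 'k::comm_ring_1"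
  where "lin_ext f p = (\<Sum>a\<in>Poly_Mapping.keys p. smul (Poly_Mapping.lookup p a) (f a))"

text \<open>Zero coefficients contribute nothing, so the sums for different arguments can be taken
  over one common finite set and compared there.\<close>

lemma lin_ext_superset:
  assumes "finite A" and "Poly_Mapping.keys p \<subseteq> A"
  shows "lin_ext f p = (\<Sum>a\<in>A. smul (Poly_Mapping.lookup p a) (f a))"
  unfolding lin_ext_def using assms
  by (intro sum.mono_neutral_left) (auto simp: in_keys_iff)

lemma lin_ext_zero [simp]: "lin_ext f 0 = 0"
  by (simp add: lin_ext_def)

lemma lin_ext_single [simp]: "lin_ext f (Poly_Mapping.single a c) = smul c (f a)"
  by (subst lin_ext_superset[of "{a}"]) auto

lemma lin_ext_add: "lin_ext f (p + r) = lin_ext f p + lin_ext f r"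
proof -
  let ?A = "Poly_Mapping.keys p \<union> Poly_Mapping.keys r"
  have "Poly_Mapping.keys (p + r) \<subseteq> ?A" by (rule keys_add)
  then show ?thesis
    by (simp add: lin_ext_superset[of ?A] lookup_add smul_add_left sum.distrib)
qed

lemma lin_ext_smul: "lin_ext f (smul c p) = smul c (lin_ext f p)"
proof -
  have "Poly_Mapping.keys (smul c p) \<subseteq> Poly_Mapping.keys p" by (auto simp: in_keys_iff)
  then show ?thesis
    by (simp add: lin_ext_superset[of "Poly_Mapping.keys p"] smul_sum)
qed

lemma lin_ext_diff: "lin_ext f (p - r) = lin_ext f p - lin_ext f r"
  using lin_ext_add[of f "p - r" r] by simp

lemma lin_ext_comp:
  assumes "\<And>p r. F (p + r) = F p + F r" and "\<And>c p. F (smul c p) = smul c (F p)"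
  shows "F (lin_ext f p) = lin_ext (\<lambda>a. F (f a)) p"
proof (induction p rule: poly_mapping_single_induct)
  case zero
  show ?case using assms(2)[of 0 0] by simp
next
  case (single_add p a c)
  then show ?case by (simp add: lin_ext_add assms)
qed

text \<open>Both sides are bilinear in \<open>p\<close> and \<open>r\<close>, so two inductions
  reduce the claim to monomials, where it is the assumption on \<open>f\<close>.\<close>

lemma lin_ext_mult:
  assumes "\<And>u v. f (u + v) = f u * f v"
  shows "lin_ext f (p * r) = lin_ext f p * lin_ext f r"
proof (induction p rule: poly_mapping_single_induct)
  case zero
  show ?case by simp
next
  case (single_add p a c)
  have "lin_ext f (Poly_Mapping.single a c * r) = smul c (f a) * lin_ext f r"
  proof (induction r rule: poly_mapping_single_induct)
    case (single_add r b d)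
    then show ?case
      by (simp add: distrib_left lin_ext_add mult_single assms smul_add mult.commute)
  qed simp
  with single_add show ?case by (simp add: lin_ext_add distrib_right)
qed

section \<open>Words\<close>

definition free_map :: "('g \<Rightarrow> 'h) \<Rightarrow> ('g, 'k::field) free_alg \<Rightarrow> ('h, 'k) free_alg"
  where "free_map f = lin_ext (\<lambda>w. Poly_Mapping.single (Word (map f (letters w))) 1)"

lemma free_map_mult: "free_map f (p * r) = free_map f p * free_map f r"
  unfolding free_map_def by (rule lin_ext_mult) (simp add: plus_free_monoid_def mult_single)

lemma free_map_gen [simp]: "free_map f (free_gen g) = free_gen (f g)"
  by (simp add: free_map_def free_gen_def)

lemma free_map_one [simp]: "free_map f 1 = 1"
proof -
  have "free_map f (Poly_Mapping.single 0 1) = Poly_Mapping.single 0 1"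
    unfolding free_map_def lin_ext_single by (simp add: zero_free_monoid_def)
  then show ?thesis by (simp only: single_one)
qed

lemma free_map_zero [simp]: "free_map f 0 = 0"
  and free_map_add: "free_map f (p + r) = free_map f p + free_map f r"
  and free_map_diff: "free_map f (p - r) = free_map f p - free_map f r"
  and free_map_smul: "free_map f (smul c p) = smul c (free_map f p)"
  by (simp_all add: free_map_def lin_ext_add lin_ext_diff lin_ext_smul)

lemma single_Word_Cons:
  "Poly_Mapping.single (Word (g # gs)) 1 = free_gen g * Poly_Mapping.single (Word gs) 1"
  by (simp add: free_gen_def mult_single plus_free_monoid_def)

lemma single_Word_Nil [simp]: "Poly_Mapping.single (Word []) 1 = (1 :: ('g, 'k::field) free_alg)"
  by (simp flip: zero_free_monoid_def)

text \<open>Words are built from the empty word by prepending letters, and scaled words add up to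
  every element. Multiplying only by a generator on the left suits left actions.\<close>

lemma free_alg_induct [case_names zero one add scale mult]:
  fixes p :: "('g, 'k::field) free_alg"
  assumes "P 0" "P 1" "\<And>p r. P p \<Longrightarrow> P r \<Longrightarrow> P (p + r)" "\<And>c p. P p \<Longrightarrow> P (scale c p)"
    and "\<And>g p. P p \<Longrightarrow> P (free_gen g * p)"
  shows "P p"
proof (induction p rule: poly_mapping_single_induct)
  case zero
  show ?case by fact
next
  case (single_add p w c)
  have "P (Poly_Mapping.single (Word gs) 1)" for gs
    by (induction gs) (auto simp: single_Word_Cons intro: assms)
  from assms(4)[OF this, of c "letters w"] have "P (Poly_Mapping.single w c)"
    by (simp add: scale_eq_smul)
  with single_add show ?case by (rule assms)
qed

section \<open>Ideals\<close>

lemma relation_ideal_zero: "0 \<in> relation_ideal rels"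
  and relation_ideal_add:
    "p \<in> relation_ideal rels \<Longrightarrow> r \<in> relation_ideal rels \<Longrightarrow> p + r \<in> relation_ideal rels"
  and relation_ideal_mult_left: "p \<in> relation_ideal rels \<Longrightarrow> a * p \<in> relation_ideal rels"
  and relation_ideal_mult_right: "p \<in> relation_ideal rels \<Longrightarrow> p * a \<in> relation_ideal rels"
proof -
  interpret I: ideal "relation_ideal rels" free_algebra by (rule ideal_relation_ideal)
  show "0 \<in> relation_ideal rels"
    using additive_subgroup.zero_closed[OF I.additive_subgroup_axioms] by (simp add: free_algebra_def)
  show "p \<in> relation_ideal rels \<Longrightarrow> r \<in> relation_ideal rels \<Longrightarrow> p + r \<in> relation_ideal rels"
    using additive_subgroup.a_closed[OF I.additive_subgroup_axioms, of p r] by (simp add: free_algebra_def)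
  show "p \<in> relation_ideal rels \<Longrightarrow> a * p \<in> relation_ideal rels"
    using I.I_l_closed[of p a] by (simp add: free_algebra_def)
  show "p \<in> relation_ideal rels \<Longrightarrow> p * a \<in> relation_ideal rels"
    using I.I_r_closed[of p a] by (simp add: free_algebra_def)
qed

lemma relation_ideal_minus: "p \<in> relation_ideal rels \<Longrightarrow> - p \<in> relation_ideal rels"
  using relation_ideal_mult_left[of p rels "- 1"] by simp

lemma relation_ideal_diff:
  "p \<in> relation_ideal rels \<Longrightarrow> r \<in> relation_ideal rels \<Longrightarrow> p - r \<in> relation_ideal rels"
  using relation_ideal_add[OF _ relation_ideal_minus, of p rels r] by simp

lemma relation_ideal_smul: "p \<in> relation_ideal rels \<Longrightarrow> smul c p \<in> relation_ideal rels"
  using relation_ideal_mult_left[of p rels "Poly_Mapping.single 0 c"]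
  by (simp add: scale_def flip: scale_eq_smul)

lemma relation_ideal_sum:
  "(\<And>a. a \<in> A \<Longrightarrow> f a \<in> relation_ideal rels) \<Longrightarrow> sum f A \<in> relation_ideal rels"
  by (induction A rule: infinite_finite_induct)
     (auto intro: relation_ideal_zero relation_ideal_add)

lemma relation_ideal_base: "(l, r) \<in> rels \<Longrightarrow> l - r \<in> relation_ideal rels"
  unfolding relation_ideal_def
  by (rule subsetD[OF ring.genideal_self[OF ring_free_algebra]]) (auto simp: free_algebra_def)

text \<open>The elements satisfying \<open>P\<close> form a two-sided ideal containing the
  generators, and the relation ideal is the smallest such. Negation needs no case of its own, being
  left multiplication by -1.\<close>

lemma relation_ideal_induct [consumes 1, case_names base zero add mult_left mult_right]:
  assumes "p \<in> relation_ideal rels"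
    and base: "\<And>l r. (l, r) \<in> rels \<Longrightarrow> P (l - r)"
    and zero: "P 0" and add: "\<And>p r. P p \<Longrightarrow> P r \<Longrightarrow> P (p + r)"
    and left: "\<And>a p. P p \<Longrightarrow> P (a * p)" and right: "\<And>a p. P p \<Longrightarrow> P (p * a)"
  shows "P p"
proof -
  interpret A: ring free_algebra by (rule ring_free_algebra)
  have minus: "P (- p)" if "P p" for p
    using left[OF that, of "- 1"] by simp
  have "ideal {p. P p} free_algebra"
  proof (rule idealI[OF ring_free_algebra])
    show "subgroup {p. P p} (add_monoid free_algebra)"
    proof (rule A.add.subgroupI)
      show "\<ominus>\<^bsub>free_algebra\<^esub> a \<in> {p. P p}" if "a \<in> {p. P p}" for a
      proof -
        have "\<ominus>\<^bsub>free_algebra\<^esub> a = - a"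
          by (rule A.minus_equality) (simp_all add: free_algebra_def)
        with that minus show ?thesis by simp
      qed
    qed (auto simp: free_algebra_def intro: zero add)
  qed (auto simp: free_algebra_def intro: left right)
  then have "relation_ideal rels \<subseteq> {p. P p}"
    unfolding relation_ideal_def by (rule A.genideal_minimal) (auto intro: base)
  with assms(1) show ?thesis by blast
qed

section \<open>Presented algebras\<close>

abbreviation presented_class ::
  "(('g, 'k::field) free_alg \<times> ('g, 'k) free_alg) set \<Rightarrow> ('g, 'k) free_alg \<Rightarrow> ('g, 'k) free_alg set"
  where "presented_class rels p \<equiv> relation_ideal rels +>\<^bsub>free_algebra\<^esub> p"

lemma presented_class_eq_iff:
  "presented_class rels p = presented_class rels r \<longleftrightarrow> p - r \<in> relation_ideal rels"
proof -
  have coset: "presented_class rels s = {t. t - s \<in> relation_ideal rels}" for s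
  proof -
    have "t \<in> presented_class rels s" if "t - s \<in> relation_ideal rels" for t
      using that by (force simp: a_r_coset_def' free_algebra_def intro!: bexI[of _ "t - s"])
    then show ?thesis by (auto simp: a_r_coset_def' free_algebra_def)
  qed
  show ?thesis
  proof
    assume "presented_class rels p = presented_class rels r"
    moreover have "p \<in> presented_class rels p" by (simp add: coset relation_ideal_zero)
    ultimately show "p - r \<in> relation_ideal rels" by (simp add: coset)
  next
    assume *: "p - r \<in> relation_ideal rels"
    have "t - r = (t - p) + (p - r)" "t - p = (t - r) - (p - r)" for t
      by simp_all
    with * show "presented_class rels p = presented_class rels r"
      unfolding coset by (metis relation_ideal_add relation_ideal_diff)
  qed
qed

lemma presented_carrier: "carrier (presented_algebra rels) = range (presented_class rels)"
  by (auto simp: presented_algebra_def Let_def FactRing_def A_RCOSETS_def' a_r_coset_def' free_algebra_def)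

lemma presented_add: "presented_class rels p \<oplus>\<^bsub>presented_algebra rels\<^esub> presented_class rels r =
    presented_class rels (p + r)"
  and presented_mult: "presented_class rels p \<otimes>\<^bsub>presented_algebra rels\<^esub> presented_class rels r =
    presented_class rels (p * r)"
  and presented_one: "\<one>\<^bsub>presented_algebra rels\<^esub> = presented_class rels 1"
  and presented_zero: "\<zero>\<^bsub>presented_algebra rels\<^esub> = presented_class rels 0"
proof -
  interpret I: ideal "relation_ideal rels" free_algebra by (rule ideal_relation_ideal)
  show "presented_class rels p \<oplus>\<^bsub>presented_algebra rels\<^esub> presented_class rels r =
      presented_class rels (p + r)"
    using I.a_rcos_sum[of p r]
    by (simp add: presented_algebra_def Let_def FactRing_def free_algebra_def)
  show "presented_class rels p \<otimes>\<^bsub>presented_algebra rels\<^esub> presented_class rels r =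
      presented_class rels (p * r)"
    using I.rcoset_mult_add[of p r]
    by (simp add: presented_algebra_def Let_def FactRing_def free_algebra_def)
  show "\<one>\<^bsub>presented_algebra rels\<^esub> = presented_class rels 1"
    by (simp add: presented_algebra_def Let_def FactRing_def free_algebra_def)
  show "\<zero>\<^bsub>presented_algebra rels\<^esub> = presented_class rels 0"
    by (simp add: presented_algebra_def Let_def FactRing_def a_r_coset_def' free_algebra_def)
qed

lemmas presented_ops =
  presented_add presented_mult presented_one presented_zero presented_smult_coset

lemma presented_a_inv:
  "\<ominus>\<^bsub>presented_algebra rels\<^esub> presented_class rels p = presented_class rels (- p)"
proof -
  interpret A: assoc_algebra "presented_algebra rels" by (rule assoc_algebra_presented_algebra)
  show ?thesis
    by (rule A.minus_equality) (simp_all add: presented_carrier presented_ops)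
qed

text \<open>The classes of noncommutative polynomials in the chosen generators form a subalgebra,
  and induction on the polynomial puts them in every subalgebra containing those generators.\<close>

lemma generated_subalgebra_presented:
  "carrier (generated_subalgebra (presented_algebra rels) (range (presented_gen rels \<circ> f))) =
    range (\<lambda>p. presented_class rels (free_map f p))"
proof -
  let ?A = "presented_algebra rels" and ?H = "range (\<lambda>p. presented_class rels (free_map f p))"
  interpret A: assoc_algebra ?A by (rule assoc_algebra_presented_algebra)
  have "presented_class rels (free_map f p) \<in> H"
    if H: "is_subalgebra H ?A" "range (presented_gen rels \<circ> f) \<subseteq> H" for H p
  proof -
    have sub: "subring H ?A" and smul: "\<And>c x. x \<in> H \<Longrightarrow> c \<odot>\<^bsub>?A\<^esub> x \<in> H"
      using H(1) by (auto simp: is_subalgebra_def)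
    have gen: "presented_class rels (free_gen (f g)) \<in> H" for g
      using H(2) by (auto simp: presented_gen_def)
    show ?thesis
    proof (induction p rule: free_alg_induct)
      case zero
      show ?case using subringE(2)[OF sub] by (simp add: presented_zero)
    next
      case one
      show ?case using subringE(3)[OF sub] by (simp add: presented_one)
    next
      case (add p r)
      from subringE(7)[OF sub this] show ?case by (simp add: presented_add free_map_add)
    next
      case (scale c p)
      from smul[OF this, of c] show ?case
        by (simp add: presented_smult_coset scale_eq_smul free_map_smul)
    next
      case (mult g p)
      from subringE(6)[OF sub gen this] show ?case by (simp add: presented_mult free_map_mult)
    qed
  qed
  moreover have "is_subalgebra ?H ?A"
    unfolding is_subalgebra_def
  proof
    show "subring ?H ?A"
    proof (rule A.subringI)
      show "\<one>\<^bsub>?A\<^esub> \<in> ?H"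
        by (rule range_eqI[of _ _ 1]) (simp add: presented_one)
    next
      fix h assume "h \<in> ?H"
      then obtain p where "h = presented_class rels (free_map f p)" by blast
      then show "\<ominus>\<^bsub>?A\<^esub> h \<in> ?H"
        using free_map_diff[of f 0 p] by (intro range_eqI[of _ _ "- p"]) (simp add: presented_a_inv)
    next
      fix h h' assume "h \<in> ?H" "h' \<in> ?H"
      then obtain p p' where *: "h = presented_class rels (free_map f p)"
        "h' = presented_class rels (free_map f p')" by blast
      then show "h \<otimes>\<^bsub>?A\<^esub> h' \<in> ?H"
        by (intro range_eqI[of _ _ "p * p'"]) (simp add: presented_mult free_map_mult)
      from * show "h \<oplus>\<^bsub>?A\<^esub> h' \<in> ?H"
        by (intro range_eqI[of _ _ "p + p'"]) (simp add: presented_add free_map_add)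
    qed (auto simp: presented_carrier)
    show "\<forall>c. \<forall>x\<in>?H. c \<odot>\<^bsub>?A\<^esub> x \<in> ?H"
      by (auto simp: presented_smult_coset scale_eq_smul simp flip: free_map_smul)
  qed
  moreover have "range (presented_gen rels \<circ> f) \<subseteq> ?H"
    by (auto simp: presented_gen_def simp flip: free_map_gen)
  ultimately show ?thesis
    unfolding generated_subalgebra_def by auto
qed

text \<open>First isomorphism theorem for the map induced by \<open>free_map f\<close>: membership
  in \<open>R\<close> passing to \<open>S\<close> makes it well defined, the converse makes it
  injective, and the description of the generated subalgebra makes it surjective.\<close>

lemma has_presentation_generated_subalgebraI:
  assumes iff: "\<And>p. free_map f p \<in> relation_ideal S \<longleftrightarrow> p \<in> relation_ideal R"
  shows "has_presentation (generated_subalgebra (presented_algebra S) (range (presented_gen S \<circ> f)))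
    (presented_gen S \<circ> f) R"
proof -
  define B where "B = generated_subalgebra (presented_algebra S) (range (presented_gen S \<circ> f))"
  have carrier: "carrier B = range (\<lambda>p. presented_class S (free_map f p))"
    by (simp only: B_def generated_subalgebra_presented)
  have B: "mult B = mult (presented_algebra S)" "add B = add (presented_algebra S)"
    "one B = one (presented_algebra S)" "smult B = smult (presented_algebra S)"
    by (simp_all add: B_def generated_subalgebra_def)
  have eq_iff: "presented_class S (free_map f p) = presented_class S (free_map f r) \<longleftrightarrow>
      presented_class R p = presented_class R r" for p r
    by (simp add: presented_class_eq_iff iff flip: free_map_diff)
  \<comment> \<open>A coset is mapped through a chosen representative; by \<open>eq_iff\<close> the
    choice does not affect the value.\<close>
  define \<phi> where "\<phi> X = presented_class S (free_map f (SOME p. X = presented_class R p))" for X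
  have \<phi>: "\<phi> (presented_class R p) = presented_class S (free_map f p)" for p
    unfolding \<phi>_def eq_iff by (rule someI2[of _ p]) auto
  have "\<phi> \<in> ring_iso (presented_algebra R) B"
    unfolding ring_iso_def bij_betw_def
    by (auto simp: ring_hom_def inj_on_def B carrier presented_carrier
        presented_ops \<phi> eq_iff free_map_add free_map_mult image_image)
  then have "\<phi> \<in> alg_iso (presented_algebra R) B"
    by (auto simp: alg_iso_def B presented_carrier presented_smult_coset \<phi> scale_eq_smul free_map_smul)
  then show ?thesis
    unfolding has_presentation_def B_def[symmetric] by (rule bexI[rotated]) (simp add: presented_gen_def \<phi>)
qed

section \<open>Modules over free algebras\<close>

text \<open>Arbitrary operators \<open>T g\<close> define a module over the free algebra. With
  \<open>foldr\<close> the rightmost letter acts first, so products act as compositions.\<close>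

definition free_act ::
  "('g \<Rightarrow> 'b \<Rightarrow> 'b \<Rightarrow>\<^sub>0 'k::field) \<Rightarrow> ('g, 'k) free_alg \<Rightarrow> ('b \<Rightarrow>\<^sub>0 'k) \<Rightarrow> 'b \<Rightarrow>\<^sub>0 'k"
  where "free_act T p m = lin_ext (\<lambda>w. foldr (\<lambda>g. lin_ext (T g)) (letters w) m) p"

lemma free_act_zero_left [simp]: "free_act T 0 m = 0"
  and free_act_add_left: "free_act T (p + r) m = free_act T p m + free_act T r m"
  and free_act_diff_left: "free_act T (p - r) m = free_act T p m - free_act T r m"
  and free_act_smul_left: "free_act T (smul c p) m = smul c (free_act T p m)"
  by (simp_all add: free_act_def lin_ext_add lin_ext_diff lin_ext_smul)

lemma free_act_gen [simp]: "free_act T (free_gen g) m = lin_ext (T g) m"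
  by (simp add: free_act_def free_gen_def)

lemma free_act_one [simp]: "free_act T 1 m = m"
proof -
  have "free_act T (Poly_Mapping.single 0 1) m = m"
    unfolding free_act_def lin_ext_single by (simp add: zero_free_monoid_def)
  then show ?thesis by (simp only: single_one)
qed

lemma free_act_gen_mult: "free_act T (free_gen g * p) m = lin_ext (T g) (free_act T p m)"
proof (induction p rule: poly_mapping_single_induct)
  case (single_add p w c)
  then show ?case
    by (simp add: distrib_left free_act_add_left lin_ext_add)
       (simp add: free_gen_def mult_single free_act_def lin_ext_smul plus_free_monoid_def)
qed simp

lemma free_act_mult: "free_act T (p * r) m = free_act T p (free_act T r m)"
proof (induction p rule: free_alg_induct)
  case (mult g p)
  then show ?case by (simp add: mult.assoc free_act_gen_mult)
qed (simp_all add: distrib_right free_act_add_left scale_eq_smul free_act_smul_left)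

lemma free_act_add_right: "free_act T p (m + n) = free_act T p m + free_act T p n"
  and free_act_smul_right: "free_act T p (smul c m) = smul c (free_act T p m)"
  by (induction p rule: free_alg_induct)
     (simp_all add: free_act_add_left scale_eq_smul free_act_smul_left free_act_gen_mult
       lin_ext_add lin_ext_smul smul_add mult.commute)

text \<open>The elements annihilating the whole module form a two-sided ideal, and by linearity a
  relation need only be tested on basis vectors.\<close>

lemma free_act_relation_ideal:
  assumes "p \<in> relation_ideal rels"
    and "\<And>l r b. (l, r) \<in> rels \<Longrightarrow>
      free_act T l (Poly_Mapping.single b 1) = free_act T r (Poly_Mapping.single b 1)"
  shows "free_act T p m = 0"
  using assms(1)
\<comment> \<open>The vector is generalised because in the case \<open>p * a\<close> the hypothesis
  is applied to the image of \<open>m\<close> under \<open>a\<close>.\<close>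
proof (induction p arbitrary: m rule: relation_ideal_induct)
  case (base l r)
  show ?case
  proof (induction m rule: poly_mapping_single_induct)
    case zero
    show ?case using free_act_smul_right[of T "l - r" 0 0] by simp
  next
    case (single_add m b c)
    have "free_act T (l - r) (smul c (Poly_Mapping.single b 1)) = 0"
      unfolding free_act_smul_right by (simp add: free_act_diff_left assms(2)[OF base])
    with single_add show ?case by (simp add: free_act_add_right)
  qed
next
  case (mult_left a p)
  then show ?case using free_act_smul_right[of T a 0 0] by (simp add: free_act_mult)
qed (simp_all add: free_act_add_left free_act_mult)

section \<open>A module for \<open>U\<^sub>q(sl\<^sub>2)\<close>\<close>

text \<open>The vector indexed by \<open>(j, i, k)\<close> plays the role of \<open>y\<^sup>j x\<^sup>i z\<^sup>k\<close>, and the formulas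
  record left multiplication by the generators. For \<open>i = 0\<close> the term with the truncated
  \<open>i - 1\<close> has coefficient \<open>0\<close>.\<close>

fun Uq_basis_act :: "'k::field \<Rightarrow> uq_symbol \<Rightarrow> int \<times> nat \<times> nat \<Rightarrow> int \<times> nat \<times> nat \<Rightarrow>\<^sub>0 'k"
  where
    "Uq_basis_act q Uq_x (j, i, k) =
      Poly_Mapping.single (j, Suc i, k) (inverse (q\<^sup>2 powi j)) +
      Poly_Mapping.single (j - 1, i, k) (1 - inverse (q\<^sup>2 powi j))"
  | "Uq_basis_act q Uq_y (j, i, k) = Poly_Mapping.single (j + 1, i, k) 1"
  | "Uq_basis_act q Uq_yinv (j, i, k) = Poly_Mapping.single (j - 1, i, k) 1"
  | "Uq_basis_act q Uq_z (j, i, k) =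
      Poly_Mapping.single (j, i, Suc k) (q\<^sup>2 powi j * inverse (q\<^sup>2) ^ i) +
      Poly_Mapping.single (j, i - 1, k) (q\<^sup>2 powi j * (1 - inverse (q\<^sup>2) ^ i)) +
      Poly_Mapping.single (j - 1, i, k) (1 - q\<^sup>2 powi j)"

lemma q_bracket_smul:
  "q_bracket q a b = smul (1 / (q - inverse q)) (smul q (a * b) - smul (inverse q) (b * a))"
  by (simp add: q_bracket_def scale_eq_smul)

lemma free_act_q_bracket:
  "free_act T (q_bracket q a b) m = smul (1 / (q - inverse q))
    (smul q (free_act T a (free_act T b m)) - smul (inverse q) (free_act T b (free_act T a m)))"
  by (simp add: q_bracket_smul free_act_smul_left free_act_diff_left free_act_mult)

lemma q_minus_inverse_nonzero:
  fixes q :: "'k::field"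
  assumes "q \<noteq> 0" "q ^ 4 \<noteq> 1"
  shows "q - inverse q \<noteq> 0"
proof
  assume "q - inverse q = 0"
  then have "q * q = 1" using assms(1) by (simp add: field_simps)
  then have "q ^ 4 = 1" by (simp add: numeral_eq_Suc mult.assoc)
  with assms(2) show False ..
qed

text \<open>Pulls coefficients out of coordinates, so that the coordinates of unit vectors become
  the unknowns of a field identity. The \<open>NO_MATCH\<close> guard keeps the rewriting from
  looping.\<close>

lemma lookup_single_scaled:
  "NO_MATCH 1 c \<Longrightarrow> Poly_Mapping.lookup (Poly_Mapping.single b c) a =
    c * Poly_Mapping.lookup (Poly_Mapping.single b (1 :: 'k::comm_ring_1)) a"
  by (simp add: lookup_single when_def)

text \<open>The six unknowns are the coordinates that occur in the relation between \<open>z\<close> and \<open>x\<close>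
  below, where \<open>s = q\<^sup>2\<^sup>j\<close>, \<open>t = q\<^sup>-\<^sup>2\<^sup>n\<close> and \<open>u\<close>, \<open>r\<close> are inverse to \<open>q\<close>, \<open>s\<close>.\<close>

lemma coefficient_identity:
  fixes q u s r t :: "'k::field"
  assumes "q * u = 1" and "s * r = 1"
  shows "q * (r * (s * (u * u * (u * u * t)) * L1 + s * (1 - u * u * (u * u * t)) * L2 +
      (1 - s) * L3) + (1 - r) * (s * (u * u) * (u * u * t) * L4 + s * (u * u) * (1 - u * u * t) * L5 +
      (1 - s * (u * u)) * L6)) -
    u * (s * (u * u * t) * (r * L1 + (1 - r) * L4) + s * (1 - u * u * t) * (r * L2 + (1 - r) * L5) +
      (1 - s) * (r * (q * q) * L3 + (1 - r * (q * q)) * L6)) = (q - u) * L2"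
  using assms by Groebner_Basis.algebra

lemma Uq_basis_act_relations:
  fixes q :: "'k::field"
  assumes q: "q \<noteq> 0" "q ^ 4 \<noteq> 1" and rel: "(l, r) \<in> Uq_relations q"
  shows "free_act (Uq_basis_act q) l (Poly_Mapping.single b 1) =
    free_act (Uq_basis_act q) r (Poly_Mapping.single b 1)"
proof -
  obtain j i k where b: "b = (j, i, k)" by (cases b) auto
  let ?act = "\<lambda>p. free_act (Uq_basis_act q) p (Poly_Mapping.single (j, i, k) 1)"
  let ?x = "free_gen Uq_x" and ?y = "free_gen Uq_y"
    and ?y' = "free_gen Uq_yinv" and ?z = "free_gen Uq_z"
  define d where "d = q - inverse q"
  have d: "d \<noteq> 0" unfolding d_def by (rule q_minus_inverse_nonzero[OF q])
  \<comment> \<open>Clears the denominator of \<open>q_bracket\<close>, so that each relation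
    becomes an identity between coordinates.\<close>
  have bracket: "smul (1 / d) (smul q m - smul (inverse q) n) = m'"
    if "smul q m - smul (inverse q) n = smul d m'" for m n m' :: "int \<times> nat \<times> nat \<Rightarrow>\<^sub>0 'k"
    using that d by simp
  define s where "s = q\<^sup>2 powi j"
  have s: "s \<noteq> 0" "q\<^sup>2 powi (j + 1) = q\<^sup>2 * s" "q\<^sup>2 powi (j - 1) = s / q\<^sup>2" "q\<^sup>2 powi j = s"
    using q(1) by (simp_all add: s_def power_int_add power_int_diff)
  have xy: "?act (q_bracket q ?x ?y) = ?act 1"
    unfolding free_act_q_bracket d_def[symmetric] using q(1) s(1)
    by (intro bracket poly_mapping_eqI)
       (simp add: lin_ext_add s lookup_add lookup_minus lookup_single_scaled d_def,
        simp add: field_simps power2_eq_square)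
  have yz: "?act (q_bracket q ?y ?z) = ?act 1"
    unfolding free_act_q_bracket d_def[symmetric] using q(1) s(1)
    by (intro bracket poly_mapping_eqI)
       (simp add: lin_ext_add s lookup_add lookup_minus lookup_single_scaled d_def,
        simp add: field_simps power2_eq_square)
  have zx: "?act (q_bracket q ?z ?x) = ?act 1"
  \<comment> \<open>For \<open>i = 0\<close> the lowering term of \<open>z\<close> has coefficient
    0. For \<open>i = Suc n\<close> the truncated subtraction disappears and all powers of
    \<open>inverse (q\<^sup>2)\<close> are multiples of \<open>t\<close>.\<close>
  proof (cases i)
    case 0
    show ?thesis
      unfolding free_act_q_bracket d_def[symmetric] using q(1) s(1)
      by (intro bracket poly_mapping_eqI)
         (simp add: lin_ext_add s 0 lookup_add lookup_minus lookup_single_scaled d_def,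
          simp add: field_simps power2_eq_square s)
  next
    case (Suc n)
    define u where "u = inverse q"
    define t where "t = (u * u) ^ n"
    define r where "r = inverse s"
    have inv: "q * u = 1" "s * r = 1"
      using q(1) s(1) by (simp_all add: u_def r_def)
    have divide: "a / q\<^sup>2 = a * (u * u)" "a / s = a * r" "inverse (q\<^sup>2) = u * u"
      "inverse u = q" for a by (simp_all add: u_def r_def power2_eq_square divide_inverse)
    show ?thesis
      unfolding free_act_q_bracket d_def[symmetric]
      by (intro bracket poly_mapping_eqI)
         (simp add: lin_ext_add s Suc lookup_add lookup_minus lookup_single_scaled d_def
            divide t_def[symmetric] u_def[symmetric] r_def[symmetric],
          rule coefficient_identity[OF inv])
  qed
  have yy: "?act (?y * ?y') = ?act 1" "?act (?y' * ?y) = ?act 1"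
    by (simp_all add: free_act_mult)
  from rel show ?thesis
    unfolding b Uq_relations_def Let_def using yy xy yz zx by fastforce
qed

section \<open>Commutation relations in \<open>U\<^sub>q\<^sup>\<or>\<close>\<close>

text \<open>Moving \<open>a\<close> past one more factor \<open>b\<close> gives the coefficient
  \<open>\<alpha> ^ n * (1 - \<alpha>) + (1 - \<alpha> ^ n) = 1 - \<alpha> ^ Suc n\<close> on the
  term with \<open>c\<close>. It is applied with \<open>c = b * b\<close> for \<open>b = w\<close>
  and with \<open>c = 1\<close> for \<open>b = x\<close>.\<close>

lemma relation_ideal_commute_power:
  assumes "a * b - (smul \<alpha> (b * a) + smul (1 - \<alpha>) c) \<in> relation_ideal rels" and c: "c * b = b * c"
  shows "a * b ^ n - (smul (\<alpha> ^ n) (b ^ n * a) + smul (1 - \<alpha> ^ n) (c * b ^ (n - 1)))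
    \<in> relation_ideal rels"
proof (induction n)
  case 0
  show ?case by (simp add: relation_ideal_zero)
next
  case (Suc n)
  have cb: "c * b ^ m = b ^ m * c" for m
    using power_commuting_commutes[OF c[symmetric], of m] by simp
  \<comment> \<open>At \<open>n = 0\<close> the truncated exponent \<open>n - 1\<close> is harmless,
    since the coefficient vanishes.\<close>
  have bc: "smul (1 - \<alpha> ^ n) (c * b ^ (n - 1) * b) = smul (1 - \<alpha> ^ n) (b ^ n * c)"
  proof (cases n)
    case (Suc m)
    have "c * b ^ m * b = b ^ Suc m * c"
      by (simp only: mult.assoc flip: power_Suc2 cb)
    then show ?thesis by (simp only: Suc diff_Suc_1)
  qed simp
  have bb: "b ^ n * (b * a) = b * (b ^ n * a)"
    by (simp add: power_commutes flip: mult.assoc)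
  let ?r = "a * b - (smul \<alpha> (b * a) + smul (1 - \<alpha>) c)"
  let ?s = "a * b ^ n - (smul (\<alpha> ^ n) (b ^ n * a) + smul (1 - \<alpha> ^ n) (c * b ^ (n - 1)))"
  have "a * b ^ Suc n - (smul (\<alpha> ^ Suc n) (b ^ Suc n * a) + smul (1 - \<alpha> ^ Suc n) (c * b ^ (Suc n - 1)))
      = ?s * b + smul (\<alpha> ^ n) (b ^ n * ?r)"
    unfolding left_diff_distrib distrib_right mult_smul_left bc
    by (rule poly_mapping_eqI)
       (simp add: cb bb lookup_add lookup_minus mult.assoc algebra_simps flip: power_Suc2)
  then show ?case
    using relation_ideal_add[OF relation_ideal_mult_right[OF Suc] relation_ideal_smul[OF relation_ideal_mult_left[OF assms(1)]]]
    by simp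
qed

text \<open>Each bracket relation is solved for the product that is out of the order
  \<open>w\<close>, \<open>x\<close>, \<open>z\<close>. The coefficients come out as \<alpha> and 1
  - \<alpha>, the shape needed for passing to powers.\<close>

lemma vee_relation_ideal_commute:
  fixes q :: "'k::field"
  assumes q: "q \<noteq> 0" "q ^ 4 \<noteq> 1"
  defines "x \<equiv> free_gen Vee_x" and "w \<equiv> free_gen Vee_yinv" and "z \<equiv> free_gen Vee_z"
  shows "x * w - (smul (q\<^sup>2) (w * x) + smul (1 - q\<^sup>2) (w * w)) \<in> relation_ideal (vee_relations q)"
    and "z * w - (smul (inverse (q\<^sup>2)) (w * z) + smul (1 - inverse (q\<^sup>2)) (w * w))
      \<in> relation_ideal (vee_relations q)"
    and "z * x - (smul (inverse (q\<^sup>2)) (x * z) + smul (1 - inverse (q\<^sup>2)) 1)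
      \<in> relation_ideal (vee_relations q)"
proof -
  define d where "d = q - inverse q"
  have d: "d \<noteq> 0" unfolding d_def by (rule q_minus_inverse_nonzero[OF q])
  have qd: "d * q = q\<^sup>2 - 1" "d * inverse q = 1 - inverse (q\<^sup>2)"
    using q(1) by (simp_all add: d_def field_simps power2_eq_square)
  have bracket: "a * b - (smul (inverse (q\<^sup>2)) (b * a) + smul (1 - inverse (q\<^sup>2)) c) =
      smul (d * inverse q) (q_bracket q a b - c)"
    and bracket': "b * a - (smul (q\<^sup>2) (a * b) + smul (1 - q\<^sup>2) c) =
      smul (- (d * q)) (q_bracket q a b - c)" for a b c :: "(vee_symbol, 'k) free_alg"
  proof -
    have "smul (d * inverse q) (q_bracket q a b - c) =
        smul (inverse q * q) (a * b) - smul (inverse q * inverse q) (b * a) - smul (d * inverse q) c"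
      using d by (simp add: q_bracket_smul smul_diff flip: d_def)
    then show "a * b - (smul (inverse (q\<^sup>2)) (b * a) + smul (1 - inverse (q\<^sup>2)) c) =
      smul (d * inverse q) (q_bracket q a b - c)"
      using q(1) by (simp add: qd power2_eq_square)
    have *: "smul (- (d * q)) (q_bracket q a b - c) =
        smul (- (q * q)) (a * b) - smul (- (q * inverse q)) (b * a) - smul (- (d * q)) c"
      using d by (simp add: q_bracket_smul smul_diff flip: d_def)
    then show "b * a - (smul (q\<^sup>2) (a * b) + smul (1 - q\<^sup>2) c) =
      smul (- (d * q)) (q_bracket q a b - c)"
      unfolding * using q(1) by (intro poly_mapping_eqI)
        (simp add: qd power2_eq_square lookup_add lookup_minus algebra_simps)
  qed
  have "(q_bracket q w x, w * w) \<in> vee_relations q" "(q_bracket q z w, w * w) \<in> vee_relations q"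
    "(q_bracket q z x, 1) \<in> vee_relations q"
    by (simp_all add: vee_relations_def Let_def x_def w_def z_def power2_eq_square)
  then show "x * w - (smul (q\<^sup>2) (w * x) + smul (1 - q\<^sup>2) (w * w)) \<in> relation_ideal (vee_relations q)"
    and "z * w - (smul (inverse (q\<^sup>2)) (w * z) + smul (1 - inverse (q\<^sup>2)) (w * w))
      \<in> relation_ideal (vee_relations q)"
    and "z * x - (smul (inverse (q\<^sup>2)) (x * z) + smul (1 - inverse (q\<^sup>2)) 1)
      \<in> relation_ideal (vee_relations q)"
    unfolding bracket bracket' by - (rule relation_ideal_smul[OF relation_ideal_base], assumption)+
qed

section \<open>Normal forms in the presented algebra\<close>

primrec vee_to_Uq :: "vee_symbol \<Rightarrow> uq_symbol"
  where
    "vee_to_Uq Vee_x = Uq_x"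
  | "vee_to_Uq Vee_yinv = Uq_yinv"
  | "vee_to_Uq Vee_z = Uq_z"

text \<open>Meant for \<open>j \<le> 0\<close>, where \<open>w\<close> has exponent -j; for positive
  \<open>j\<close> the conversion \<open>nat\<close> gives the default exponent 0.\<close>

fun vee_monomial :: "int \<times> nat \<times> nat \<Rightarrow> (vee_symbol, 'k::field) free_alg"
  where "vee_monomial (j, i, k) =
    free_gen Vee_yinv ^ nat (- j) * free_gen Vee_x ^ i * free_gen Vee_z ^ k"

text \<open>Reordering a generator times a monomial by the power commutations reproduces the
  formulas of \<open>Uq_basis_act\<close>, so sending basis vectors to monomials respects the action
  modulo the relations.\<close>

lemma vee_monomial_step:
  fixes q :: "'k::field"
  assumes q: "q \<noteq> 0" "q ^ 4 \<noteq> 1" and j: "j \<le> 0"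
  shows "lin_ext vee_monomial (Uq_basis_act q (vee_to_Uq g) (j, i, k)) -
    free_gen g * vee_monomial (j, i, k) \<in> relation_ideal (vee_relations q)"
proof -
  define n where "n = nat (- j)"
  have j: "j = - int n" using j by (simp add: n_def)
  have n: "nat (1 + int n) = Suc n" by simp
  let ?p = "inverse (q\<^sup>2)"
  have p: "q\<^sup>2 powi (- int n) = ?p ^ n" "inverse (?p ^ n) = q\<^sup>2 ^ n"
    by (simp_all add: power_int_minus power_inverse)
  define x :: "(vee_symbol, 'k) free_alg" where "x = free_gen Vee_x"
  define w :: "(vee_symbol, 'k) free_alg" where "w = free_gen Vee_yinv"
  define z :: "(vee_symbol, 'k) free_alg" where "z = free_gen Vee_z"
  note commute = vee_relation_ideal_commute[OF q, folded x_def w_def z_def]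
  \<comment> \<open>Here \<open>c = w * w\<close>, so \<open>c * w ^ (n - 1)\<close> is
    \<open>w ^ Suc n\<close> for positive \<open>n\<close>, and at \<open>n = 0\<close> the
    coefficient is 0.\<close>
  have shift: "smul (1 - \<alpha> ^ n) (w * w * w ^ (n - 1)) = smul (1 - \<alpha> ^ n) (w ^ Suc n)" for \<alpha>
    by (cases n) (simp_all add: mult.assoc)
  \<comment> \<open>For this \<open>c\<close> the hypothesis \<open>c * b = b * c\<close> is an
    instance of associativity.\<close>
  note xw = relation_ideal_commute_power[OF commute(1) mult.assoc, of n, unfolded shift]
    and zw = relation_ideal_commute_power[OF commute(2) mult.assoc, of n, unfolded shift]
    and zx = relation_ideal_commute_power[OF commute(3), of i]
  show ?thesis
  proof (cases g)
    case Vee_x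
    have "lin_ext vee_monomial (Uq_basis_act q (vee_to_Uq g) (j, i, k)) - x * vee_monomial (j, i, k) =
      - (x * w ^ n - (smul (q\<^sup>2 ^ n) (w ^ n * x) + smul (1 - q\<^sup>2 ^ n) (w ^ Suc n))) * (x ^ i * z ^ k)"
      by (simp add: Vee_x j n p lin_ext_add left_diff_distrib distrib_right mult.assoc
          flip: x_def w_def z_def)
    with relation_ideal_mult_right[OF relation_ideal_minus[OF xw]] show ?thesis
      by (simp add: Vee_x x_def)
  next
    case Vee_yinv
    have "lin_ext vee_monomial (Uq_basis_act q (vee_to_Uq g) (j, i, k)) = w * vee_monomial (j, i, k)"
      by (simp add: Vee_yinv j n mult.assoc flip: x_def w_def z_def)
    then show ?thesis by (simp add: Vee_yinv w_def relation_ideal_zero)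
  next
    case Vee_z
    \<comment> \<open>Two moves are needed: \<open>z\<close> first passes \<open>w ^ n\<close>, and
      the resulting term with \<open>w ^ n * z\<close> then needs \<open>z\<close> to pass
      \<open>x ^ i\<close>.\<close>
    have "lin_ext vee_monomial (Uq_basis_act q (vee_to_Uq g) (j, i, k)) - z * vee_monomial (j, i, k) =
      - (z * w ^ n - (smul (?p ^ n) (w ^ n * z) + smul (1 - ?p ^ n) (w ^ Suc n))) * (x ^ i * z ^ k) -
      smul (?p ^ n)
        (w ^ n * (z * x ^ i - (smul (?p ^ i) (x ^ i * z) + smul (1 - ?p ^ i) (1 * x ^ (i - 1)))) * z ^ k)"
      by (simp add: Vee_z j n p lin_ext_add left_diff_distrib right_diff_distrib distrib_right
          distrib_left smul_add smul_diff mult.assoc flip: x_def w_def z_def)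
    moreover have "\<dots> \<in> relation_ideal (vee_relations q)"
      by (intro relation_ideal_diff relation_ideal_smul relation_ideal_mult_right
          relation_ideal_mult_left relation_ideal_minus zw zx) simp
    ultimately show ?thesis by (simp add: Vee_z z_def)
  qed
qed

lemma keys_lin_ext: "Poly_Mapping.keys (lin_ext f p) \<subseteq> (\<Union>a\<in>Poly_Mapping.keys p. Poly_Mapping.keys (f a))"
proof -
  have "Poly_Mapping.lookup (lin_ext f p) b = 0" if "\<forall>a\<in>Poly_Mapping.keys p. b \<notin> Poly_Mapping.keys (f a)" for b
    using that by (simp add: lin_ext_def lookup_sum in_keys_iff)
  then show ?thesis by (fastforce simp: in_keys_iff)
qed

text \<open>Only \<open>y\<close> raises \<open>j\<close>, and \<open>y\<close> is not in the range
  of \<open>vee_to_Uq\<close>; the other generators keep \<open>j\<close> or lower it by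
  one.\<close>

lemma Uq_basis_act_keys:
  assumes "j \<le> 0"
  shows "Poly_Mapping.keys (Uq_basis_act q (vee_to_Uq g) (j, i, k)) \<subseteq> {b. fst b \<le> 0}"
  using assms by (cases g) (auto dest!: subsetD[OF keys_add] split: if_splits)

text \<open>Both claims are proved together: in the product step the generator is compared with its
  action basis vector by basis vector, which requires every index in the support to satisfy
  \<open>j \<le> 0\<close>.\<close>

lemma vee_normal_form:
  fixes q :: "'k::field"
  assumes q: "q \<noteq> 0" "q ^ 4 \<noteq> 1"
  defines "act \<equiv> \<lambda>p. free_act (Uq_basis_act q) (free_map vee_to_Uq p) (Poly_Mapping.single (0, 0, 0) 1)"
  shows "Poly_Mapping.keys (act p) \<subseteq> {b. fst b \<le> 0} \<and>
    lin_ext vee_monomial (act p) - p \<in> relation_ideal (vee_relations q)"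
    (is "?keys (act p) \<and> ?cong (act p) p")
proof (induction p rule: free_alg_induct)
  case zero
  show ?case by (simp add: act_def relation_ideal_zero)
next
  case one
  show ?case by (simp add: act_def relation_ideal_zero)
next
  case (add p r)
  have "act (p + r) = act p + act r"
    by (simp add: act_def free_map_add free_act_add_left)
  with add show ?case
    using keys_add[of "act p" "act r"]
      relation_ideal_add[of "lin_ext vee_monomial (act p) - p" _ "lin_ext vee_monomial (act r) - r"]
    by (auto simp: lin_ext_add algebra_simps)
next
  case (scale c p)
  have *: "act (smul c p) = smul c (act p)"
    by (simp add: act_def free_map_smul free_act_smul_left)
  have "?keys (smul c (act p))" using scale by (auto simp: in_keys_iff)
  moreover have "?cong (smul c (act p)) (smul c p)"
    using relation_ideal_smul[OF conjunct2[OF scale], of c] by (simp add: lin_ext_smul flip: smul_diff)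
  ultimately show ?case by (simp only: * scale_eq_smul)
next
  case (mult g p)
  let ?T = "Uq_basis_act q (vee_to_Uq g)"
  have *: "act (free_gen g * p) = lin_ext ?T (act p)"
    by (simp add: act_def free_map_mult free_act_mult)
  have "?keys (lin_ext ?T (act p))"
    using mult keys_lin_ext[of ?T "act p"] Uq_basis_act_keys[of _ q g] by fastforce
  moreover have "?cong (lin_ext ?T (act p)) (free_gen g * p)"
  proof -
    have "lin_ext vee_monomial (lin_ext ?T (act p)) - free_gen g * lin_ext vee_monomial (act p) =
        (\<Sum>b\<in>Poly_Mapping.keys (act p). smul (Poly_Mapping.lookup (act p) b)
          (lin_ext vee_monomial (?T b) - free_gen g * vee_monomial b))"
      unfolding lin_ext_comp[of "lin_ext vee_monomial", OF lin_ext_add lin_ext_smul]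
      by (simp add: lin_ext_def[of _ "act p"] sum_distrib_left smul_diff sum_subtractf)
    also have "\<dots> \<in> relation_ideal (vee_relations q)"
    proof (rule relation_ideal_sum)
      fix b assume "b \<in> Poly_Mapping.keys (act p)"
      with mult obtain j i k where "b = (j, i, k)" "j \<le> 0" by (cases b) auto
      with vee_monomial_step[OF q this(2)]
      show "smul (Poly_Mapping.lookup (act p) b)
          (lin_ext vee_monomial (?T b) - free_gen g * vee_monomial b) \<in> relation_ideal (vee_relations q)"
        by (simp only: relation_ideal_smul)
    qed
    finally have 1: "lin_ext vee_monomial (lin_ext ?T (act p)) - free_gen g * lin_ext vee_monomial (act p)
      \<in> relation_ideal (vee_relations q)" .
    have 2: "free_gen g * (lin_ext vee_monomial (act p) - p) \<in> relation_ideal (vee_relations q)"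
      using mult by (blast intro: relation_ideal_mult_left)
    from relation_ideal_add[OF 1 2] show ?thesis by (simp add: algebra_simps)
  qed
  ultimately show ?case by (simp only: *)
qed

section \<open>Comparison of the two relation ideals\<close>

lemma free_map_vee_relation_ideal:
  fixes q :: "'k::field"
  assumes "p \<in> relation_ideal (vee_relations q)"
  shows "free_map vee_to_Uq p \<in> relation_ideal (Uq_relations q)"
  using assms
proof (induction p rule: relation_ideal_induct)
  case (base l r)
  let ?I = "relation_ideal (Uq_relations q)"
  define x :: "(uq_symbol, 'k) free_alg" where "x = free_gen Uq_x"
  define y :: "(uq_symbol, 'k) free_alg" where "y = free_gen Uq_y"
  define w :: "(uq_symbol, 'k) free_alg" where "w = free_gen Uq_yinv"
  define z :: "(uq_symbol, 'k) free_alg" where "z = free_gen Uq_z"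
  have I: "y * w - 1 \<in> ?I" "w * y - 1 \<in> ?I" "q_bracket q x y - 1 \<in> ?I" "q_bracket q y z - 1 \<in> ?I"
    "q_bracket q z x - 1 \<in> ?I"
    by (rule relation_ideal_base; simp add: Uq_relations_def Let_def x_def y_def w_def z_def)+
  \<comment> \<open>Absorbing the denominator into two opaque scalars leaves the identities below
    linear in \<open>a\<close> and \<open>b\<close>.\<close>
  define a b where "a = 1 / (q - inverse q) * q" and "b = 1 / (q - inverse q) * inverse q"
  have bracket: "q_bracket q u v = smul a (u * v) - smul b (v * u)" for u v :: "('g, 'k) free_alg"
    by (simp add: q_bracket_smul smul_diff a_def b_def)
  \<comment> \<open>The relation is multiplied by \<open>w\<close> on both sides; the two correction
    terms replace \<open>y * w\<close> and \<open>w * y\<close> by 1.\<close>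
  have "q_bracket q w x - w * w =
      w * (q_bracket q x y - 1) * w - smul a (w * x * (y * w - 1)) + smul b ((w * y - 1) * x * w)"
    by (simp add: bracket algebra_simps smul_diff)
  moreover have "\<dots> \<in> ?I"
    by (intro relation_ideal_add relation_ideal_diff relation_ideal_smul relation_ideal_mult_left I(1)
        relation_ideal_mult_right[OF relation_ideal_mult_left[OF I(3)]]
        relation_ideal_mult_right[OF relation_ideal_mult_right[OF I(2)]])
  ultimately have wx: "q_bracket q w x - w * w \<in> ?I" by simp
  have "q_bracket q z w - w * w =
      w * (q_bracket q y z - 1) * w - smul a ((w * y - 1) * z * w) + smul b (w * z * (y * w - 1))"
    by (simp add: bracket algebra_simps smul_diff)
  moreover have "\<dots> \<in> ?I"
    by (intro relation_ideal_add relation_ideal_diff relation_ideal_smul relation_ideal_mult_left I(1)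
        relation_ideal_mult_right[OF relation_ideal_mult_left[OF I(4)]]
        relation_ideal_mult_right[OF relation_ideal_mult_right[OF I(2)]])
  ultimately have zw: "q_bracket q z w - w * w \<in> ?I" by simp
  have "free_map vee_to_Uq (q_bracket q u v) = q_bracket q (free_map vee_to_Uq u) (free_map vee_to_Uq v)"
    for u v by (simp add: bracket free_map_diff free_map_smul free_map_mult)
  with base wx zw I(5) show ?case
    by (auto simp: vee_relations_def Let_def free_map_diff free_map_mult power2_eq_square
        x_def y_def w_def z_def)
qed (auto simp: free_map_add free_map_mult relation_ideal_zero
      intro: relation_ideal_add relation_ideal_mult_left relation_ideal_mult_right)

theorem theorem10p9:
  fixes q :: "'k::field"
  assumes "q \<noteq> 0" and "q ^ 4 \<noteq> 1"
  shows "has_presentation (Uq_vee q) (Uq_vee_gen q) (vee_relations q)"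
proof -
  have "free_map vee_to_Uq p \<in> relation_ideal (Uq_relations q) \<longleftrightarrow> p \<in> relation_ideal (vee_relations q)"
    for p
  proof
    assume "free_map vee_to_Uq p \<in> relation_ideal (Uq_relations q)"
    then have "free_act (Uq_basis_act q) (free_map vee_to_Uq p) m = 0" for m
      by (rule free_act_relation_ideal) (rule Uq_basis_act_relations[OF assms])
    \<comment> \<open>The vector obtained from (0, 0, 0) is 0, so its image in the free algebra is 0
      and the normal form congruence leaves only \<open>- p\<close>.\<close>
    with vee_normal_form[OF assms, of p] have "- p \<in> relation_ideal (vee_relations q)" by simp
    from relation_ideal_minus[OF this] show "p \<in> relation_ideal (vee_relations q)" by simp
  qed (rule free_map_vee_relation_ideal)
  note presentation = has_presentation_generated_subalgebraI[OF this]
  have gen: "presented_gen (Uq_relations q) \<circ> vee_to_Uq = Uq_vee_gen q"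
  proof
    show "(presented_gen (Uq_relations q) \<circ> vee_to_Uq) g = Uq_vee_gen q g" for g
      by (cases g) (simp_all add: Uq_gen_def)
  qed
  have "range (Uq_vee_gen q) = {Uq_gen q Uq_x, Uq_gen q Uq_yinv, Uq_gen q Uq_z}"
  proof -
    have "Uq_vee_gen q g \<in> {Uq_gen q Uq_x, Uq_gen q Uq_yinv, Uq_gen q Uq_z}" for g
      by (cases g) simp_all
    then show ?thesis
      using rangeI[of "Uq_vee_gen q" Vee_x] rangeI[of "Uq_vee_gen q" Vee_yinv]
        rangeI[of "Uq_vee_gen q" Vee_z] by auto
  qed
  with presentation show ?thesis
    by (simp add: gen Uq_vee_def Uq_def)
qed

end
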